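(* Let $a,b,c,\nu\in\mathbb{C}$ with $\Re(c)>\Re(b)>0$, and suppose that either $p>0$, or $p=0$ and $\nu=0$. Then: (i) for all $z\in\mathbb{C}$ with $|\arg(1-z)|<\pi$, $$F_{p,\nu}(a,b;c;z)=\sqrt{\frac{2p}{\pi}}\,\frac{1}{B(b,c-b)}\int_0^1 t^{b-\frac{3}{2}}(1-t)^{c-b-\frac{3}{2}}(1-zt)^{-a}\, K_{\nu+\frac{1}{2}}\left(\frac{p}{t(1-t)}\right)dt;$$ (ii) for all $z\in\mathbb{C}$, $$\Phi_{p,\nu}(b;c;z)= \sqrt{\frac{2p}{\pi}}\,\frac{1}{ B(b,c-b)}\int_0^1 t^{b-\frac{3}{2}}(1-t)^{c-b-\frac{3}{2}}\,e^{zt}\, K_{\nu+\frac{1}{2}}\left(\frac{p}{t(1-t)}\right)dt.$$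
   Context: $K_\mu(z)$ denotes the modified Bessel function of the second kind of order $\mu$; $B(x,y)$ (two arguments) is the classical Beta function; $(a)_n$ is the Pochhammer symbol $(a)_0=1$, $(a)_n=a(a+1)\cdots(a+n-1)$. For $p>0$ the extended Beta function is $$B_{\nu}(x,y;p):= \sqrt{\frac{2p}{\pi}}\int_{0}^{1} t^{x-\frac{3}{2}}(1-t)^{y-\frac{3}{2}}\, K_{\nu+\frac{1}{2}}\left(\frac{p}{t(1-t)}\right)dt .$$ Since $K_{1/2}(w)=\sqrt{\pi/(2w)}\,e^{-w}$, for $\nu=0$ the product $\sqrt{2p/\pi}\,K_{1/2}\left(\frac{p}{t(1-t)}\right)$ equals $\sqrt{t(1-t)}\,e^{-p/(t(1-t))}$; when $p=0$ and $\nu=0$ it is read as $\sqrt{t(1-t)}$, so that $B_0(x,y;0)=B(x,y)$ for $\Re(x),\Re(y)>0$. For $\Re(c)>\Re(b)>0$ define $$F_{p,\nu}(a,b;c;z):=\sum_{n=0}^\infty(a)_n\,\frac{B_{\nu}(b+n,c-b;p)}{B(b,c-b)}\,\frac{z^n}{n!}\quad(|z|<1),$$ extended to $|\arg(1-z)|<\pi$ (i.e. $z\in\mathbb{C}\setminus[1,\infty)$) by analytic continuation, and $$\Phi_{p,\nu}(b;c;z):=\sum_{n=0}^\infty \frac{B_{\nu}(b+n,c-b;p)}{B(b,c-b)}\,\frac{z^n}{n!}\quad(z\in\mathbb{C}).$$ Powers take principal values. *)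

theory Defs
  imports "HOL-Complex_Analysis.Complex_Analysis"
begin

text \<open>
  The modified Bessel function of the second kind \<open>K\<^sub>\<mu>(w)\<close> on the half-plane \<open>Re w > 0\<close>, by
  \<open>K\<^sub>\<mu>(w) = \<integral>\<^sub>0\<^sup>\<infinity> exp (-w cosh u) cosh (\<mu>u) du\<close>. The integral converges there for every complex
  order, integers included. Outside the half-plane the value is not meaningful.
\<close>
definition bessel_K :: "complex \<Rightarrow> complex \<Rightarrow> complex" where
  "bessel_K \<mu> w = (LBINT u:{0..}. exp (- w * cosh (of_real u)) * cosh (\<mu> * of_real u))"

lemma bessel_K_half:
  assumes w: "w > (0::real)"
  shows "bessel_K (1/2) (of_real w) = of_real (sqrt (pi / (2 * w)) * exp (- w))"
proof -
  define g where "g = (\<lambda>u::real. w * (cosh u - 1))"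
  define f where "f = (\<lambda>s::real. s powr (1/2 - 1) / exp s)"
  define h where "h = (\<lambda>u. exp (- w * cosh u) * cosh (u/2))"
  have inj: "inj_on g {0<..}"
    using w by (auto simp: g_def inj_on_def arcosh_cosh_real dest: arg_cong[of _ _ arcosh])
  have img: "g ` {0<..} = {0<..}"
  proof (intro equalityI subsetI)
    fix s assume "s \<in> g ` {0<..}"
    then show "s \<in> {0<..}" using w cosh_real_strict_mono[of 0] by (auto simp: g_def)
  next
    fix s :: real assume s: "s \<in> {0<..}"
    then have "s = g (arcosh (1 + s/w))" "arcosh (1 + s/w) > 0"
      using w by (auto simp: g_def)
    then show "s \<in> g ` {0<..}" by auto
  qed
  have hI: "(f has_integral Gamma (1/2)) {0<..}"
  proof -
    have "(f has_integral Gamma (1/2)) {0..}"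
      unfolding f_def by (rule Gamma_integral_real) simp
    hence "((\<lambda>t. if t \<in> {0<..} then f t else 0) has_integral Gamma (1/2)) {0..}"
      by (rule has_integral_spike [of "{0}", rotated 2]) auto
    also have "?this = ?thesis"
      by (subst has_integral_restrict) auto
    finally show ?thesis .
  qed
  have fabs: "f absolutely_integrable_on {0<..}"
    using hI by (intro nonnegative_absolutely_integrable_1) (auto simp: f_def integrable_on_def)
  have cv: "(\<lambda>x. \<bar>w * sinh x\<bar> * f (g x)) absolutely_integrable_on {0<..} \<and>
     integral {0<..} (\<lambda>x. \<bar>w * sinh x\<bar> * f (g x)) = sqrt pi"
    by (subst has_absolute_integral_change_of_variables_1'[where g = g])
       (use inj img fabs hI in \<open>auto simp: g_def Gamma_one_half_real integral_unique
          intro!: derivative_eq_intros\<close>)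
  have eq: "\<bar>w * sinh x\<bar> * f (g x) = sqrt (2 * w) * exp w * h x" if "x > 0" for x
  proof -
    have s: "sinh (x/2) > 0" using that by simp
    have g: "g x = 2 * w * sinh (x/2) ^ 2"
      using cosh_double_cosh[of "x/2"] by (simp add: g_def cosh_square_eq algebra_simps)
    have gp: "g x > 0" using s w by (simp add: g)
    have "g x powr (1/2 - 1) = 1 / sqrt (g x)"
      using gp by (simp add: powr_minus powr_half_sqrt[symmetric] field_simps)
    also have "sqrt (g x) = sqrt (2 * w) * sinh (x/2)"
      using s by (simp add: g real_sqrt_mult)
    finally have fg: "f (g x) = 1 / (sqrt (2*w) * sinh (x/2)) * (exp w * exp (- w * cosh x))"
      by (simp add: f_def) (simp add: g_def exp_diff exp_minus field_simps)
    have ws: "\<bar>w * sinh x\<bar> = sqrt (2*w) * sqrt (2*w) * sinh (x/2) * cosh (x/2)"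
      using sinh_double[of "x/2"] w that by (simp add: abs_mult)
    have alg: "q * q * r * k * (1 / (q * r) * (e * e')) = q * e * (e' * k)"
      if "q > 0" "r > 0" for q r k e e' :: real
      using that by (simp add: field_simps)
    have "sqrt (2 * w) > 0" using w by simp
    from alg[OF this s] fg ws show ?thesis unfolding h_def by (simp only:)
  qed
  have A: "(\<lambda>x. sqrt (2 * w) * exp w * h x) absolutely_integrable_on {0<..}"
    using cv by (subst set_integrable_cong[OF refl refl, where f' = "\<lambda>x. \<bar>w * sinh x\<bar> * f (g x)"]) (auto simp: eq)
  have "integral {0<..} (\<lambda>x. sqrt (2 * w) * exp w * h x) = sqrt pi"
    using cv by (subst integral_cong[where g = "\<lambda>x. \<bar>w * sinh x\<bar> * f (g x)"]) (auto simp: eq)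
  then have I: "integral {0<..} h = sqrt (pi / (2 * w)) * exp (- w)"
    using w by (simp add: real_sqrt_divide exp_minus field_simps)
  have habs: "h absolutely_integrable_on {0<..}"
    using absolutely_integrable_scaleR_left[OF A, of "inverse (sqrt (2 * w) * exp w)"] w
    by (simp add: field_simps)
  have hm: "h \<in> borel_measurable borel"
    unfolding h_def cosh_def by measurable
  have hb: "set_integrable lborel {0<..} h"
    using habs hm unfolding set_integrable_def
    by (subst (asm) integrable_completion) auto
  have "bessel_K (1/2) (of_real w) = (LBINT u:{0..}. complex_of_real (h u))"
    unfolding bessel_K_def h_def
    by (intro set_lebesgue_integral_cong)
       (auto simp: cosh_def scaleR_conv_of_real exp_of_real[symmetric])
  also have "\<dots> = of_real (LBINT u:{0..}. h u)"
    by (rule set_integral_complex_of_real)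
  also have "(LBINT u:{0..}. h u) = (LBINT u:{0<..}. h u)"
    unfolding set_lebesgue_integral_def
    using AE_lborel_singleton[of "0::real"] hm
    by (intro integral_cong_AE) (auto simp: indicator_def)
  also have "\<dots> = integral {0<..} h"
    using hb by (rule set_borel_integral_eq_integral)
  finally show ?thesis using I by simp
qed

text \<open>
  The product \<open>sqrt (2p/\<pi>) K\<^bsub>\<nu>+1/2\<^esub>(p/(t(1-t)))\<close>. In the degenerate case \<open>p = \<nu> = 0\<close> it is
  read as its limit \<open>sqrt (t(1-t))\<close> for \<open>p \<rightarrow> 0\<close>.
\<close>
definition ext_kernel :: "real \<Rightarrow> complex \<Rightarrow> real \<Rightarrow> complex" where
  "ext_kernel p \<nu> t =
     (if p = 0 \<and> \<nu> = 0 then of_real (sqrt (t * (1 - t)))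
      else of_real (sqrt (2 * p / pi)) * bessel_K (\<nu> + 1/2) (of_real (p / (t * (1 - t)))))"

lemma ext_kernel_0:
  assumes "p \<ge> 0" "0 < t" "t < 1"
  shows "ext_kernel p 0 t = of_real (sqrt (t * (1 - t)) * exp (- p / (t * (1 - t))))"
proof (cases "p = 0")
  case False
  define w where "w = p / (t * (1 - t))"
  have pos: "w > 0" "t * (1 - t) > 0" using assms False by (auto simp: w_def)
  have "sqrt (2 * p / pi) * sqrt (pi / (2 * w)) = sqrt (t * (1 - t))"
    using False pos by (simp add: real_sqrt_mult[symmetric] w_def)
  moreover have "ext_kernel p 0 t = of_real (sqrt (2 * p / pi) * (sqrt (pi / (2 * w)) * exp (- w)))"
    using False bessel_K_half[OF pos(1)] by (simp add: ext_kernel_def w_def)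
  ultimately show ?thesis by (simp add: w_def mult.assoc[symmetric] flip: of_real_mult)
qed (simp add: ext_kernel_def)

definition ext_Beta :: "complex \<Rightarrow> complex \<Rightarrow> complex \<Rightarrow> real \<Rightarrow> complex" where
  "ext_Beta \<nu> x y p =
     (LBINT t:{0<..<1}. of_real t powr (x - 3/2) * of_real (1 - t) powr (y - 3/2) * ext_kernel p \<nu> t)"

text \<open>
  The domain \<open>\<bar>arg (1 - z)\<bar> < \<pi>\<close>. It is not written with \<open>Arg\<close> because \<open>Arg 0 = 0\<close>
  would let in the branch point \<open>z = 1\<close>.
\<close>
definition cut_plane :: "complex set" where
  "cut_plane = - (complex_of_real ` {1..})"

text \<open>
  The analytic continuation to the cut plane of the sum of the series on the unit disc. Since the
  cut plane is connected, any two such continuations agree on it.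
\<close>
definition ext_hypergeometric ::
    "real \<Rightarrow> complex \<Rightarrow> complex \<Rightarrow> complex \<Rightarrow> complex \<Rightarrow> complex \<Rightarrow> complex" where
  "ext_hypergeometric p \<nu> a b c =
     (SOME f. f holomorphic_on cut_plane \<and>
        (\<forall>z. norm z < 1 \<longrightarrow>
           (\<lambda>n. pochhammer a n * (ext_Beta \<nu> (b + of_nat n) (c - b) p / Beta b (c - b)) * (z ^ n / fact n))
             sums f z))"

definition ext_confluent ::
    "real \<Rightarrow> complex \<Rightarrow> complex \<Rightarrow> complex \<Rightarrow> complex \<Rightarrow> complex" where
  "ext_confluent p \<nu> b c z =
     (\<Sum>n. ext_Beta \<nu> (b + of_nat n) (c - b) p / Beta b (c - b) * (z ^ n / fact n))"

end

theory Submission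
  imports Defs
begin

text \<open>
  Both series are power series whose \<open>n\<close>-th coefficient contains the \<open>n\<close>-th moment of one and the
  same weight on \<open>(0,1)\<close>. The weight is integrable: since \<open>cosh \<ge> 1\<close>, the Bessel factor decays like
  \<open>exp (-p/(t(1-t)))\<close>, which dominates the endpoint singularities. Integrating the
  exponential and the binomial series term by term gives the formulas for \<open>\<Phi>\<close>, and for \<open>F\<close> on the unit disc.
  The integral for \<open>F\<close> is holomorphic in \<open>z\<close> on the connected cut plane, by dominated convergence of
  the difference quotients, so it is the analytic continuation there.
\<close>

section \<open>Integrals against an integrable weight\<close>

text \<open>Continuity up to the endpoints makes \<open>\<phi>\<close> bounded by compactness, so a
  constant multiple of \<open>g\<close> dominates the product on the open interval.\<close>

lemma set_integrable_mult_continuous: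
  fixes g \<phi> :: "real \<Rightarrow> complex"
  assumes g: "set_integrable lborel {0<..<1} g" and \<phi>: "continuous_on {0..1} \<phi>"
  shows "set_integrable lborel {0<..<1} (\<lambda>t. \<phi> t * g t)"
proof -
  have "bounded (\<phi> ` {0..1})"
    using \<phi> by (intro compact_imp_bounded compact_continuous_image) auto
  then obtain C where C: "\<And>t. t \<in> {0..1} \<Longrightarrow> norm (\<phi> t) \<le> C"
    unfolding bounded_iff by blast
  have "(\<lambda>t. indicator {0<..<1} t *\<^sub>R \<phi> t) \<in> borel_measurable borel"
    by (intro borel_measurable_continuous_on_indicator continuous_on_subset[OF \<phi>]) auto
  moreover have "(\<lambda>t. indicator {0<..<1} t *\<^sub>R g t) \<in> borel_measurable borel"
    using g by (auto simp: set_integrable_def dest: borel_measurable_integrable)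
  ultimately have "(\<lambda>t. (indicator {0<..<1} t *\<^sub>R \<phi> t) * (indicator {0<..<1} t *\<^sub>R g t))
      \<in> borel_measurable borel"
    by measurable
  also have "(\<lambda>t. (indicator {0<..<1} t *\<^sub>R \<phi> t) * (indicator {0<..<1} t *\<^sub>R g t)) =
      (\<lambda>t. indicator {0<..<1} t *\<^sub>R (\<phi> t * g t))"
    by (auto simp: indicator_def)
  finally have meas: "set_borel_measurable lborel {0<..<1} (\<lambda>t. \<phi> t * g t)"
    by (simp add: set_borel_measurable_def)
  have "set_integrable lborel {0<..<1} (\<lambda>t. of_real C * g t)"
    using g by simp
  then show ?thesis
  proof (rule set_integrable_bound[OF _ meas])
    show "AE t in lborel. t \<in> {0<..<1} \<longrightarrow> norm (\<phi> t * g t) \<le> norm (of_real C * g t)"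
    proof (intro always_eventually allI impI)
      fix t :: real assume "t \<in> {0<..<1}"
      with C[of t] have "norm (\<phi> t) \<le> \<bar>C\<bar>" by auto
      then show "norm (\<phi> t * g t) \<le> norm (of_real C * g t)"
        by (simp add: norm_mult mult_right_mono)
    qed
  qed
qed

text \<open>Since \<open>t ^ n \<le> 1\<close> on the unit interval, the n-th term is at most
  \<open>norm (q n * z ^ n)\<close> times the norm of the weight. Absolute convergence at the single
  point \<open>z\<close> therefore makes the integrals of the norms summable, and sum and integral
  may be interchanged.\<close>

lemma power_moments_sums:
  fixes g :: "real \<Rightarrow> complex" and q :: "nat \<Rightarrow> complex"
  assumes g: "set_integrable lborel {0<..<1} g"
    and q: "summable (\<lambda>n. norm (q n * z ^ n))"
  shows "(\<lambda>n. q n * z ^ n * (LBINT t:{0<..<1}. of_real t ^ n * g t)) sums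
           (LBINT t:{0<..<1}. (\<Sum>n. q n * (z * of_real t) ^ n) * g t)"
proof -
  define G where "G = (\<lambda>t. indicator {0<..<1} t *\<^sub>R g t)"
  define f where "f = (\<lambda>n t. q n * z ^ n * (of_real t ^ n * G t))"
  have G: "integrable lborel G"
    using g by (simp add: G_def set_integrable_def)
  have intf: "integrable lborel (f n)" for n
  proof -
    have "set_integrable lborel {0<..<1} (\<lambda>t. (q n * z ^ n * of_real t ^ n) * g t)"
      by (intro set_integrable_mult_continuous[OF g] continuous_intros)
    then show ?thesis
      by (simp add: f_def G_def set_integrable_def mult_ac scaleR_conv_of_real)
  qed
  have bound: "norm (f n t) \<le> norm (q n * z ^ n) * norm (G t)" for n t
  proof (cases "t \<in> {0<..<1}")
    case True
    then have "\<bar>t\<bar> ^ n \<le> 1" by (intro power_le_one) auto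
    then have "norm (of_real t ^ n * G t) \<le> norm (G t)"
      by (simp add: norm_mult norm_power mult_left_le_one_le)
    then show ?thesis
      unfolding f_def norm_mult[of "q n * z ^ n"] by (intro mult_left_mono) auto
  qed (simp add: f_def G_def)
  have "(\<lambda>n. integral\<^sup>L lborel (f n)) sums (\<integral>t. (\<Sum>n. f n t) \<partial>lborel)"
  proof (rule sums_integral[OF intf])
    show "AE t in lborel. summable (\<lambda>n. norm (f n t))"
      by (intro always_eventually allI summable_comparison_test'[OF summable_mult2[OF q]])
         (use bound in auto)
    have "norm (\<integral>t. norm (f n t) \<partial>lborel) \<le> norm (q n * z ^ n) * (\<integral>t. norm (G t) \<partial>lborel)" for n
    proof -
      have "(\<integral>t. norm (f n t) \<partial>lborel) \<le> (\<integral>t. norm (q n * z ^ n) * norm (G t) \<partial>lborel)"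
        by (intro integral_mono integrable_norm intf integrable_mult_right G bound)
      then show ?thesis by simp
    qed
    then show "summable (\<lambda>n. \<integral>t. norm (f n t) \<partial>lborel)"
      by (intro summable_comparison_test'[OF summable_mult2[OF q]]) auto
  qed
  moreover have "integral\<^sup>L lborel (f n) = q n * z ^ n * (LBINT t:{0<..<1}. of_real t ^ n * g t)" for n
  proof -
    have "f n = (\<lambda>t. q n * z ^ n * (indicator {0<..<1} t *\<^sub>R (of_real t ^ n * g t)))"
      by (simp add: f_def G_def fun_eq_iff)
    then show ?thesis
      unfolding set_lebesgue_integral_def by (simp only: integral_mult_right_zero)
  qed
  moreover have "(\<integral>t. (\<Sum>n. f n t) \<partial>lborel) =
      (LBINT t:{0<..<1}. (\<Sum>n. q n * (z * of_real t) ^ n) * g t)"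
    unfolding set_lebesgue_integral_def
  proof (intro Bochner_Integration.integral_cong refl)
    fix t :: real
    show "(\<Sum>n. f n t) =
        indicator {0<..<1} t *\<^sub>R ((\<Sum>n. q n * (z * of_real t) ^ n) * g t)"
    proof (cases "t \<in> {0<..<1}")
      case True
      have "summable (\<lambda>n. norm (q n * (z * of_real t) ^ n))"
      proof (rule summable_comparison_test'[OF q])
        fix n
        have "\<bar>t\<bar> ^ n \<le> 1" using True by (intro power_le_one) auto
        then show "norm (norm (q n * (z * of_real t) ^ n)) \<le> norm (q n * z ^ n)"
          by (simp add: norm_mult norm_power power_mult_distrib mult_left_le mult_left_mono)
      qed
      then have "summable (\<lambda>n. q n * (z * of_real t) ^ n)"
        by (rule summable_norm_cancel)
      from suminf_mult2[OF this, of "g t"] True show ?thesis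
        by (simp add: f_def G_def power_mult_distrib mult_ac)
    qed (simp add: f_def G_def)
  qed
  ultimately show ?thesis by simp
qed

text \<open>Differentiation under the integral sign. The difference quotients of \<open>h\<close>
  are bounded, uniformly in \<open>t\<close>, by the supremum of \<open>h'\<close> on a compact
  product of a ball and the unit interval, so a multiple of \<open>norm (g t)\<close> serves as
  majorant.\<close>

lemma holomorphic_on_weighted_integral:
  fixes g :: "real \<Rightarrow> complex" and h h' :: "complex \<Rightarrow> real \<Rightarrow> complex"
  assumes g: "set_integrable lborel {0<..<1} g" and U: "open U"
    and h: "\<And>z. z \<in> U \<Longrightarrow> continuous_on {0..1} (h z)"
    and deriv: "\<And>z t. z \<in> U \<Longrightarrow> t \<in> {0..1} \<Longrightarrow>
      ((\<lambda>z. h z t) has_field_derivative h' z t) (at z)"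
    and h': "continuous_on (U \<times> {0..1}) (\<lambda>(z, t). h' z t)"
  shows "(\<lambda>z. LBINT t:{0<..<1}. h z t * g t) holomorphic_on U"
proof -
  define H where "H = (\<lambda>z. LBINT t:{0<..<1}. h z t * g t)"
  have "(H has_field_derivative (LBINT t:{0<..<1}. h' w t * g t)) (at w)" if w: "w \<in> U" for w
  proof -
    obtain r where r: "r > 0" "cball w r \<subseteq> U"
      using U w open_contains_cball by blast
    have "continuous_on (cball w r \<times> {0..1}) (\<lambda>(z, t). h' z t)"
      by (rule continuous_on_subset[OF h']) (use r in auto)
    then have "bounded ((\<lambda>(z, t). h' z t) ` (cball w r \<times> {0..1}))"
      by (intro compact_imp_bounded compact_continuous_image compact_Times) auto
    then obtain C where "\<forall>x \<in> (\<lambda>(z, t). h' z t) ` (cball w r \<times> {0..1}). norm x \<le> C"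
      unfolding bounded_iff by blast
    then have C: "norm (h' z t) \<le> C" if "z \<in> cball w r" "t \<in> {0..1}" for z t
    proof -
      have "(\<lambda>(z, t). h' z t) (z, t) \<in> (\<lambda>(z, t). h' z t) ` (cball w r \<times> {0..1})"
        using that by (intro imageI) simp
      then show ?thesis
        using \<open>\<forall>x \<in> _. norm x \<le> C\<close> by (simp only: prod.case)
    qed
    \<comment> \<open>Mean value inequality on the convex ball; dividing by
      \<open>norm (z - w)\<close> bounds every difference quotient by \<open>C\<close>.\<close>
    have lip: "norm (h z t - h w t) \<le> C * norm (z - w)" if "z \<in> cball w r" "t \<in> {0..1}" for z t
    proof (rule field_differentiable_bound[of "cball w r" "\<lambda>z. h z t" "\<lambda>z. h' z t"])
      fix y assume "y \<in> cball w r"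
      with r have "y \<in> U" by blast
      from has_field_derivative_at_within[OF deriv[OF this that(2)]]
      show "((\<lambda>z. h z t) has_field_derivative h' y t) (at y within cball w r)" .
    next
      show "norm (h' y t) \<le> C" if "y \<in> cball w r" for y
        using that \<open>t \<in> {0..1}\<close> by (rule C)
    qed (use r that in simp_all)
    have cont': "continuous_on {0..1} (h' w)"
    proof -
      have "continuous_on {0..1} (\<lambda>t. (\<lambda>(z, t). h' z t) (w, t))"
        by (rule continuous_on_compose2[OF h']) (use w in \<open>auto intro!: continuous_intros\<close>)
      then show ?thesis by simp
    qed
    have inth: "set_integrable lborel {0<..<1} (\<lambda>t. h z t * g t)" if "z \<in> U" for z
      by (rule set_integrable_mult_continuous[OF g h[OF that]])
    \<comment> \<open>Dominated convergence concerns sequences, so the limit is tested along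
      sequences \<open>X\<close> tending to \<open>w\<close>. They are kept in the ball, where
      \<open>C\<close> is a valid bound; as \<open>w\<close> is an interior point, this does not
      change the limit.\<close>
    have "((\<lambda>z. (H z - H w) / (z - w)) \<longlongrightarrow> (LBINT t:{0<..<1}. h' w t * g t)) (at w within cball w r)"
      unfolding tendsto_at_iff_sequentially
    proof (intro allI impI)
      fix X assume X: "\<forall>i. X i \<in> cball w r - {w}" "X \<longlonglongrightarrow> w"
      have XU: "X i \<in> U" "X i \<noteq> w" "X i \<in> cball w r" for i using X(1) r by auto
      define s where "s = (\<lambda>i t. indicator {0<..<1} t *\<^sub>R ((h (X i) t - h w t) / (X i - w) * g t))"
      have "set_integrable lborel {0<..<1} (\<lambda>t. (h (X i) t - h w t) / (X i - w) * g t)" for i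
        by (intro set_integrable_mult_continuous[OF g] continuous_intros h XU w)
           (use XU(2)[of i] in auto)
      then have ints: "integrable lborel (s i)" for i
        by (simp add: s_def set_integrable_def)
      have "(\<lambda>i. integral\<^sup>L lborel (s i)) \<longlonglongrightarrow>
          (\<integral>t. indicator {0<..<1} t *\<^sub>R (h' w t * g t) \<partial>lborel)"
      proof (rule integral_dominated_convergence[where w = "\<lambda>t. C * norm (indicator {0<..<1} t *\<^sub>R g t)"])
        show "(\<lambda>t. indicator {0<..<1} t *\<^sub>R (h' w t * g t)) \<in> borel_measurable lborel"
          using set_integrable_mult_continuous[OF g cont']
          by (auto simp: set_integrable_def dest: borel_measurable_integrable)
        show "s i \<in> borel_measurable lborel" for i
          using ints by (rule borel_measurable_integrable)
        show "integrable lborel (\<lambda>t. C * norm (indicator {0<..<1} t *\<^sub>R g t))"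
          using g unfolding set_integrable_def by (intro integrable_mult_right integrable_norm)
        show "AE t in lborel. (\<lambda>i. s i t) \<longlonglongrightarrow> indicator {0<..<1} t *\<^sub>R (h' w t * g t)"
        proof (intro always_eventually allI)
          fix t :: real
          show "(\<lambda>i. s i t) \<longlonglongrightarrow> indicator {0<..<1} t *\<^sub>R (h' w t * g t)"
          proof (cases "t \<in> {0<..<1}")
            case True
            then have "((\<lambda>z. (h z t - h w t) / (z - w)) \<longlongrightarrow> h' w t) (at w)"
              using deriv[OF w, of t] by (simp add: has_field_derivative_iff)
            then have "(\<lambda>i. (h (X i) t - h w t) / (X i - w)) \<longlonglongrightarrow> h' w t"
              using X(2) XU(2) unfolding tendsto_at_iff_sequentially by (auto simp: comp_def)
            then show ?thesis
              unfolding s_def by (intro tendsto_intros)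
          qed (simp add: s_def)
        qed
        show "AE t in lborel. norm (s i t) \<le> C * norm (indicator {0<..<1} t *\<^sub>R g t)" for i
        proof (intro always_eventually allI)
          fix t :: real
          show "norm (s i t) \<le> C * norm (indicator {0<..<1} t *\<^sub>R g t)"
          proof (cases "t \<in> {0<..<1}")
            case True
            then have "norm ((h (X i) t - h w t) / (X i - w)) \<le> C"
              using lip[of "X i" t] XU[of i] by (simp add: norm_divide field_simps)
            from mult_right_mono[OF this norm_ge_zero[of "g t"]] True show ?thesis
              by (simp add: s_def norm_mult norm_divide)
          qed (simp add: s_def)
        qed
      qed
      moreover have "integral\<^sup>L lborel (s i) = (H (X i) - H w) / (X i - w)" for i
      proof -
        have "H (X i) - H w = (LBINT t:{0<..<1}. h (X i) t * g t - h w t * g t)"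
          unfolding H_def by (intro set_integral_diff(2)[symmetric] inth XU w)
        then have "(H (X i) - H w) / (X i - w) =
            (LBINT t:{0<..<1}. (h (X i) t * g t - h w t * g t) / (X i - w))"
          by simp
        then show ?thesis
          by (simp add: s_def set_lebesgue_integral_def algebra_simps diff_divide_distrib)
      qed
      ultimately show "((\<lambda>z. (H z - H w) / (z - w)) \<circ> X) \<longlonglongrightarrow> (LBINT t:{0<..<1}. h' w t * g t)"
        by (simp add: comp_def set_lebesgue_integral_def)
    qed
    moreover have "at w within cball w r = at w"
      using r by (intro at_within_interior) (auto simp: interior_cball)
    ultimately show ?thesis by (simp add: has_field_derivative_iff)
  qed
  then show ?thesis
    unfolding H_def[symmetric] using U
    by (auto simp: holomorphic_on_open)
qed

section \<open>Integrability of the weight\<close>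

text \<open>\<open>cosh\<close> grows at least quadratically on the half-line, so
  \<open>- w * cosh u\<close> beats any linear exponent and leaves a multiple of
  \<open>exp (- u)\<close> as majorant.\<close>

lemma set_integrable_exp_cosh:
  fixes w \<sigma> :: real
  assumes w: "w > 0"
  shows "set_integrable lborel {0..} (\<lambda>u. exp (- w * cosh u) * exp (\<sigma> * u))"
proof -
  \<comment> \<open>The constant left over when the square is completed in
    \<open>w * (u\<^sup>2 / 4) - (\<sigma> + 1) * u\<close>; the extra 1 in
    \<open>\<sigma> + 1\<close> is what produces the decay \<open>exp (- u)\<close>.\<close>
  define K where "K = (\<sigma> + 1)\<^sup>2 / w"
  have "(\<lambda>u::real. exp (- 1 * u)) absolutely_integrable_on {0..}"
    by (intro nonnegative_absolutely_integrable_1 integrable_on_exp_minus_to_infinity) auto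
  \<comment> \<open>Absolute integrability is a statement about the completed measure; for a Borel
    function it descends to \<open>lborel\<close>.\<close>
  then have "set_integrable lborel {0..} (\<lambda>u::real. exp (- u))"
    unfolding set_integrable_def by (subst (asm) integrable_completion) auto
  then have "set_integrable lborel {0..} (\<lambda>u::real. exp K * exp (- u))"
    by simp
  then show ?thesis
  proof (rule set_integrable_bound)
    show "set_borel_measurable lborel {0..} (\<lambda>u. exp (- w * cosh u) * exp (\<sigma> * u))"
      unfolding set_borel_measurable_def cosh_def by measurable
    show "AE u in lborel. u \<in> {0..} \<longrightarrow>
        norm (exp (- w * cosh u) * exp (\<sigma> * u)) \<le> norm (exp K * exp (- u))"
    proof (intro always_eventually allI impI)
      fix u :: real assume u: "u \<in> {0..}"
      \<comment> \<open>Half of the Taylor bound \<open>1 + u + u\<^sup>2 / 2 \<le> exp u\<close>,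
        with the positive term \<open>exp (- u)\<close> dropped.\<close>
      have "u\<^sup>2 / 4 \<le> cosh u"
        using exp_lower_Taylor_quadratic[of u] u exp_gt_zero[of "-u"]
        by (simp add: cosh_def del: exp_gt_zero)
      then have "w * (u\<^sup>2 / 4) \<le> w * cosh u"
        using w by (intro mult_left_mono) auto
      moreover have "0 \<le> w * (u / 2 - (\<sigma> + 1) / w)\<^sup>2"
        using w by simp
      moreover have "w * (u / 2 - (\<sigma> + 1) / w)\<^sup>2 = w * (u\<^sup>2 / 4) - (\<sigma> + 1) * u + K"
        using w by (simp add: K_def power2_eq_square field_simps)
      ultimately have "- w * cosh u + \<sigma> * u \<le> K - u"
        by (simp add: algebra_simps)
      then show "norm (exp (- w * cosh u) * exp (\<sigma> * u)) \<le> norm (exp K * exp (- u))"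
        by (simp flip: exp_add)
    qed
  qed
qed

lemma norm_cosh_complex_le: "norm (cosh (\<mu> * of_real u)) \<le> exp (\<bar>Re \<mu>\<bar> * u)" if "u \<ge> 0"
proof -
  have le: "norm (cosh (\<mu> * of_real u)) \<le> (exp (Re \<mu> * u) + exp (- (Re \<mu> * u))) / 2"
    using norm_triangle_ineq[of "exp (\<mu> * of_real u)" "exp (- (\<mu> * of_real u))"]
    by (simp add: cosh_def)
  have "Re \<mu> * u \<le> \<bar>Re \<mu>\<bar> * u" "- (Re \<mu> * u) \<le> \<bar>Re \<mu>\<bar> * u"
    using that mult_right_mono[of "Re \<mu>" "\<bar>Re \<mu>\<bar>" u] mult_right_mono[of "- Re \<mu>" "\<bar>Re \<mu>\<bar>" u]
    by auto
  then have "exp (Re \<mu> * u) \<le> exp (\<bar>Re \<mu>\<bar> * u)" "exp (- (Re \<mu> * u)) \<le> exp (\<bar>Re \<mu>\<bar> * u)"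
    by (simp_all only: exp_le_cancel_iff)
  from add_mono[OF this] le show ?thesis by (simp add: field_simps)
qed

text \<open>Since \<open>cosh \<ge> 1\<close>, the factor \<open>exp (-(w - w\<^sub>0))\<close> can be split off the integrand of \<open>K\<^sub>\<mu>(w)\<close>.\<close>
lemma bessel_K_exp_decay:
  assumes w0: "w0 > 0"
  obtains C where "C \<ge> 0" "\<And>w. w \<ge> w0 \<Longrightarrow> norm (bessel_K \<mu> (of_real w)) \<le> C * exp (- (w - w0))"
proof
  define k where "k = (\<lambda>u::real. exp (- w0 * cosh u) * exp (\<bar>Re \<mu>\<bar> * u))"
  have k: "set_integrable lborel {0..} k"
    unfolding k_def by (rule set_integrable_exp_cosh[OF w0])
  \<comment> \<open>The integral of \<open>k\<close> is the witness for \<open>C\<close>: the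
    majorant \<open>k\<close> is built from \<open>w0\<close> alone, so one constant serves all
    \<open>w \<ge> w0\<close>.\<close>
  show "(LBINT u:{0..}. k u) \<ge> 0"
    by (simp add: k_def set_lebesgue_integral_def)
  fix w :: real assume w: "w \<ge> w0"
  define f where "f = (\<lambda>u::real. exp (- of_real w * cosh (of_real u)) * cosh (\<mu> * of_real u))"
  have bound: "norm (f u) \<le> k u * exp (- (w - w0))" if "u \<ge> 0" for u
  proof -
    have "(w - w0) * 1 \<le> (w - w0) * cosh u"
      using w by (intro mult_left_mono cosh_real_ge_1) auto
    then have "exp (- w * cosh u) \<le> exp (- w0 * cosh u) * exp (- (w - w0))"
      by (simp add: algebra_simps flip: exp_add)
    moreover have "norm (exp (- complex_of_real w * cosh (of_real u))) = exp (- w * cosh u)"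
    proof -
      have "cosh (complex_of_real u) = of_real (cosh u)"
        by (simp add: cosh_def scaleR_conv_of_real exp_of_real[symmetric])
      then show ?thesis by simp
    qed
    ultimately have "norm (f u) \<le> (exp (- w0 * cosh u) * exp (- (w - w0))) * exp (\<bar>Re \<mu>\<bar> * u)"
      unfolding f_def norm_mult using norm_cosh_complex_le[OF that] by (intro mult_mono) auto
    then show ?thesis by (simp add: k_def mult_ac)
  qed
  have fm: "set_borel_measurable lborel {0..} f"
    unfolding set_borel_measurable_def f_def cosh_def by measurable
  have ki: "set_integrable lborel {0..} (\<lambda>u. k u * exp (- (w - w0)))"
    using k by simp
  have f: "set_integrable lborel {0..} f"
    by (rule set_integrable_bound[OF ki fm]) (use bound in \<open>auto simp: k_def\<close>)
  have "norm (bessel_K \<mu> (of_real w)) \<le> (LBINT u:{0..}. norm (f u))"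
    unfolding bessel_K_def f_def[symmetric] using f by (rule set_integral_norm_bound)
  also have "\<dots> \<le> (LBINT u:{0..}. k u * exp (- (w - w0)))"
    using bound by (intro set_integral_mono set_integrable_norm f ki) auto
  finally show "norm (bessel_K \<mu> (of_real w)) \<le> (LBINT u:{0..}. k u) * exp (- (w - w0))"
    by simp
qed

text \<open>A parameter integral of a jointly measurable integrand is measurable in the parameter,
  so no continuity of the Bessel function has to be established.\<close>

lemma borel_measurable_bessel_K_real [measurable]:
  "(\<lambda>w. bessel_K \<mu> (complex_of_real w)) \<in> borel_measurable borel"
  unfolding bessel_K_def set_lebesgue_integral_def cosh_def by measurable

lemma borel_measurable_ext_kernel [measurable]: "ext_kernel p \<nu> \<in> borel_measurable borel"
  unfolding ext_kernel_def by measurable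

text \<open>The square root is the exact size of the kernel in the degenerate case. For
  \<open>p > 0\<close> the exponential decay gives more, and the bound is weakened to this common
  form so that both cases continue together.\<close>

lemma ext_kernel_bound:
  assumes "p > 0 \<or> (p = 0 \<and> \<nu> = 0)"
  obtains C where "C \<ge> 0"
    "\<And>t. 0 < t \<Longrightarrow> t < 1 \<Longrightarrow> norm (ext_kernel p \<nu> t) \<le> C * sqrt (t * (1 - t))"
proof (cases "p = 0")
  case True
  with assms have "norm (ext_kernel p \<nu> t) \<le> 1 * sqrt (t * (1 - t))" if "0 < t" "t < 1" for t
    using that by (simp add: ext_kernel_def)
  then show ?thesis using that[of 1] by simp
next
  case False
  with assms have p: "p > 0" by simp
  define \<mu> where "\<mu> = \<nu> + 1/2"
  \<comment> \<open>As \<open>t * (1 - t) \<le> 1/4\<close>, the Bessel argument never falls below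
    \<open>4 * p\<close>, which is therefore the threshold for the decay estimate.\<close>
  obtain C where C: "C \<ge> 0"
    "\<And>w. w \<ge> 4 * p \<Longrightarrow> norm (bessel_K \<mu> (of_real w)) \<le> C * exp (- (w - 4 * p))"
    using bessel_K_exp_decay[of "4 * p" \<mu>] p by auto
  \<comment> \<open>The factor \<open>exp (4 * p)\<close> comes from the shift in the decay
    estimate, and \<open>1 / p\<close> from \<open>exp (- w) \<le> 1 / w\<close> with
    \<open>1 / w = t * (1 - t) / p\<close>.\<close>
  define D where "D = sqrt (2 * p / pi) * C * exp (4 * p) / p"
  show ?thesis
  proof (rule that[of D])
    show "D \<ge> 0" using p C(1) by (simp add: D_def)
    fix t :: real assume t: "0 < t" "t < 1"
    define w where "w = p / (t * (1 - t))"
    define s where "s = t * (1 - t)"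
    have s: "s > 0" using t by (simp add: s_def)
    have s4: "s \<le> 1/4"
      using zero_le_power2[of "t - 1/2"] by (simp add: s_def power2_eq_square algebra_simps)
    have w: "w \<ge> 4 * p" "w > 0"
      using p s s4 by (auto simp: w_def s_def[symmetric] field_simps)
    have "w \<le> exp w"
      using exp_ge_add_one_self[of w] by linarith
    then have "exp (- w) \<le> 1 / w"
      using w by (simp add: exp_minus field_simps)
    then have e: "exp (- (w - 4 * p)) \<le> exp (4 * p) * (s / p)"
      using mult_left_mono[of "exp (- w)" "1 / w" "exp (4 * p)"]
      by (simp add: w_def s_def flip: exp_add)
    have "s * s \<le> s * 1" using s s4 by (intro mult_left_mono) auto
    then have sq: "s \<le> sqrt s"
      by (intro real_le_rsqrt) (simp add: power2_eq_square)
    have "norm (ext_kernel p \<nu> t) = sqrt (2 * p / pi) * norm (bessel_K \<mu> (of_real w))"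
      using p by (simp add: ext_kernel_def \<mu>_def w_def norm_mult)
    also have "\<dots> \<le> sqrt (2 * p / pi) * (C * (exp (4 * p) * (s / p)))"
      using p C(1) C(2)[OF w(1)] mult_left_mono[OF e C(1)] by (intro mult_left_mono) auto
    also have "\<dots> = D * s" by (simp add: D_def)
    also have "\<dots> \<le> D * sqrt s"
      using sq \<open>D \<ge> 0\<close> by (rule mult_left_mono)
    finally show "norm (ext_kernel p \<nu> t) \<le> D * sqrt (t * (1 - t))" by (simp add: s_def)
  qed
qed

text \<open>The kernel bound contributes a power 1/2 at each endpoint. This lifts the real exponents
  from \<open>- 3/2\<close> to \<open>- 1\<close>, so a multiple of the classical Beta integrand is
  a majorant.\<close>

lemma set_integrable_ext_Beta_integrand:
  assumes x: "Re x > 0" and y: "Re y > 0" and p: "p > 0 \<or> (p = 0 \<and> \<nu> = 0)"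
  shows "set_integrable lborel {0<..<1}
    (\<lambda>t. of_real t powr (x - 3/2) * of_real (1 - t) powr (y - 3/2) * ext_kernel p \<nu> t)"
    (is "set_integrable _ _ ?g")
proof -
  obtain C where C: "C \<ge> 0"
    "\<And>t. 0 < t \<Longrightarrow> t < 1 \<Longrightarrow> norm (ext_kernel p \<nu> t) \<le> C * sqrt (t * (1 - t))"
    using ext_kernel_bound[OF p] by blast
  have "set_integrable lborel {0<..<1} (\<lambda>t. t powr (Re x - 1) * (1 - t) powr (Re y - 1))"
    using integrable_Beta[OF x y] by (rule set_integrable_subset) auto
  then have "set_integrable lborel {0<..<1} (\<lambda>t. C * (t powr (Re x - 1) * (1 - t) powr (Re y - 1)))"
    by simp
  then show ?thesis
  proof (rule set_integrable_bound)
    \<comment> \<open>For measurability the complex powers are written through the real logarithm.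
      The two forms agree on the open interval, and the indicator removes all other points.\<close>
    have "(\<lambda>t. indicator {0<..<1} t *\<^sub>R (exp ((x - 3/2) * of_real (ln t)) *
        exp ((y - 3/2) * of_real (ln (1 - t))) * ext_kernel p \<nu> t)) \<in> borel_measurable lborel"
      by measurable
    also have "(\<lambda>t. indicator {0<..<1} t *\<^sub>R (exp ((x - 3/2) * of_real (ln t)) *
        exp ((y - 3/2) * of_real (ln (1 - t))) * ext_kernel p \<nu> t)) =
        (\<lambda>t. indicator {0<..<1} t *\<^sub>R ?g t)"
    proof
      fix t :: real
      show "indicator {0<..<1} t *\<^sub>R (exp ((x - 3/2) * of_real (ln t)) *
        exp ((y - 3/2) * of_real (ln (1 - t))) * ext_kernel p \<nu> t) = indicator {0<..<1} t *\<^sub>R ?g t"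
      proof (cases "t \<in> {0<..<1}")
        case True
        then have "complex_of_real t \<noteq> 0" "complex_of_real (1 - t) \<noteq> 0"
          "Ln (complex_of_real t) = of_real (ln t)"
          "Ln (complex_of_real (1 - t)) = of_real (ln (1 - t))"
          by (auto simp only: Ln_of_real of_real_eq_0_iff greaterThanLessThan_iff diff_gt_0_iff_gt)
        then show ?thesis by (simp only: powr_def if_False)
      qed simp
    qed
    finally show "set_borel_measurable lborel {0<..<1} ?g"
      unfolding set_borel_measurable_def .
    show "AE t in lborel. t \<in> {0<..<1} \<longrightarrow>
        norm (?g t) \<le> norm (C * (t powr (Re x - 1) * (1 - t) powr (Re y - 1)))"
    proof (intro always_eventually allI impI)
      fix t :: real assume "t \<in> {0<..<1}"
      then have t: "0 < t" "t < 1" by auto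
      have "norm (?g t) = t powr (Re x - 3/2) * (1 - t) powr (Re y - 3/2) * norm (ext_kernel p \<nu> t)"
        using t norm_powr_real_powr[of "of_real t" "x - 3/2"]
          norm_powr_real_powr[of "of_real (1 - t)" "y - 3/2"]
        by (simp add: norm_mult)
      also have "\<dots> \<le> t powr (Re x - 3/2) * (1 - t) powr (Re y - 3/2) * (C * sqrt (t * (1 - t)))"
        using C t by (intro mult_left_mono) auto
      also have "sqrt (t * (1 - t)) = t powr (1/2) * (1 - t) powr (1/2)"
        using t by (simp add: powr_half_sqrt real_sqrt_mult)
      also have "t powr (Re x - 3/2) * (1 - t) powr (Re y - 3/2) * (C * (t powr (1/2) * (1 - t) powr (1/2)))
          = C * ((t powr (Re x - 3/2) * t powr (1/2)) * ((1 - t) powr (Re y - 3/2) * (1 - t) powr (1/2)))"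
        by (simp add: mult_ac)
      also have "\<dots> = C * (t powr (Re x - 1) * (1 - t) powr (Re y - 1))"
        by (simp flip: powr_add)
      finally show "norm (?g t) \<le> norm (C * (t powr (Re x - 1) * (1 - t) powr (Re y - 1)))"
        using C(1) by simp
    qed
  qed
qed

text \<open>This turns the coefficients of both series into moments of one fixed weight, the shape
  required by \<open>power_moments_sums\<close>.\<close>

lemma ext_Beta_add_of_nat:
  "ext_Beta \<nu> (x + of_nat n) y p = (LBINT t:{0<..<1}. of_real t ^ n *
     (of_real t powr (x - 3/2) * of_real (1 - t) powr (y - 3/2) * ext_kernel p \<nu> t))"
  unfolding ext_Beta_def
proof (intro set_lebesgue_integral_cong ballI allI impI)
  fix t :: real assume "t \<in> {0<..<1}"
  then have "of_real t powr (x + of_nat n - 3/2) = of_real t ^ n * (of_real t powr (x - 3/2) :: complex)"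
    using powr_add[of "complex_of_real t" "of_nat n" "x - 3/2"]
    by (simp add: powr_nat' algebra_simps)
  then show "of_real t powr (x + of_nat n - 3/2) * of_real (1 - t) powr (y - 3/2) * ext_kernel p \<nu> t =
    of_real t ^ n * (of_real t powr (x - 3/2) * of_real (1 - t) powr (y - 3/2) * ext_kernel p \<nu> t)"
    by simp
qed auto

section \<open>The cut plane\<close>

lemma open_cut_plane: "open cut_plane"
proof -
  have "closed (complex_of_real ` {1..})"
    by (intro closed_injective_linear_image) (auto simp: inj_on_def intro: bounded_linear.linear bounded_linear_of_real)
  then show ?thesis unfolding cut_plane_def by (rule open_Compl)
qed

text \<open>If \<open>z * of_real t\<close> were real and at least 1, then \<open>t > 0\<close> and
  \<open>z\<close> itself would be real and at least \<open>1 / t \<ge> 1\<close>, hence on the cut.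
  So the principal power of \<open>1 - z * of_real t\<close> stays off its branch cut for all
  \<open>t\<close>, endpoints included.\<close>

lemma one_minus_mult_notin_nonpos_Reals:
  assumes "z \<in> cut_plane" "t \<in> {0..1}"
  shows "1 - z * of_real t \<notin> \<real>\<^sub>\<le>\<^sub>0"
proof
  assume "1 - z * of_real t \<in> \<real>\<^sub>\<le>\<^sub>0"
  then have *: "Im z * t = 0" "Re z * t \<ge> 1"
    by (auto simp: complex_nonpos_Reals_iff)
  then have t: "t > 0" using assms(2) by (cases "t = 0") auto
  with * have "Im z = 0" by simp
  have "Re z * t > 0" using *(2) by linarith
  then have "Re z > 0" using t by (simp add: zero_less_mult_iff)
  then have "Re z * t \<le> Re z * 1"
    using assms(2) by (intro mult_left_mono) auto
  with *(2) have "Re z \<ge> 1" by linarith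
  with \<open>Im z = 0\<close> have "z \<in> complex_of_real ` {1..}"
    by (intro image_eqI[of _ _ "Re z"]) (auto simp: complex_eq_iff)
  with assms(1) show False by (simp add: cut_plane_def)
qed

text \<open>The domain is an arbitrary topological space because the lemma serves both for fixed
  \<open>z\<close>, on the interval, and jointly in \<open>z\<close> and \<open>t\<close>, on a
  product.\<close>

lemma continuous_on_powr_const_complex:
  fixes f :: "'a :: topological_space \<Rightarrow> complex"
  assumes "continuous_on A f" "\<And>x. x \<in> A \<Longrightarrow> f x \<notin> \<real>\<^sub>\<le>\<^sub>0"
  shows "continuous_on A (\<lambda>x. f x powr s)"
proof -
  have "continuous_on A (\<lambda>x. exp (s * Ln (f x)))"
    using assms by (intro continuous_intros) auto
  moreover have "f x \<noteq> 0" if "x \<in> A" for x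
    using assms(2)[OF that] by auto
  ultimately show ?thesis
    by (subst continuous_on_cong[OF refl, where g = "\<lambda>x. exp (s * Ln (f x))"]) (auto simp: powr_def)
qed

text \<open>The set is star-shaped about 0: shrinking a point towards 0 cannot move it onto the
  ray.\<close>

lemma connected_cut_plane: "connected cut_plane"
proof (rule starlike_imp_connected)
  have "closed_segment 0 z \<subseteq> cut_plane" if z: "z \<in> cut_plane" for z
  proof
    fix y assume "y \<in> closed_segment 0 z"
    then obtain t where t: "t \<in> {0..1}" "y = z * of_real t"
      by (auto simp: in_segment scaleR_conv_of_real mult.commute)
    show "y \<in> cut_plane"
    proof (rule ccontr)
      assume "y \<notin> cut_plane"
      then have "1 - y \<in> \<real>\<^sub>\<le>\<^sub>0"
        by (auto simp: cut_plane_def complex_nonpos_Reals_iff)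
      with one_minus_mult_notin_nonpos_Reals[OF z t(1)] t(2) show False by simp
    qed
  qed
  moreover have "0 \<in> cut_plane" by (auto simp: cut_plane_def)
  ultimately show "starlike cut_plane" by (auto simp: starlike_def)
qed

lemma ball_subset_cut_plane: "ball 0 1 \<subseteq> cut_plane"
  by (auto simp: cut_plane_def)

section \<open>The integral representations\<close>

theorem theorem7:
  fixes a b c \<nu> :: complex and p :: real
  assumes "Re c > Re b" and "Re b > 0"
    and "p > 0 \<or> (p = 0 \<and> \<nu> = 0)"
  shows "(\<forall>z \<in> cut_plane.
            ext_hypergeometric p \<nu> a b c z =
              1 / Beta b (c - b) *
              (LBINT t:{0<..<1}. of_real t powr (b - 3/2) * of_real (1 - t) powr (c - b - 3/2)
                 * (1 - z * of_real t) powr (- a) * ext_kernel p \<nu> t)) \<and>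
         (\<forall>z :: complex.
            ext_confluent p \<nu> b c z =
              1 / Beta b (c - b) *
              (LBINT t:{0<..<1}. of_real t powr (b - 3/2) * of_real (1 - t) powr (c - b - 3/2)
                 * exp (z * of_real t) * ext_kernel p \<nu> t))"
proof -
  define g where "g = (\<lambda>t. of_real t powr (b - 3/2) * of_real (1 - t) powr (c - b - 3/2) * ext_kernel p \<nu> t)"
  define B where "B = Beta b (c - b)"
  have g: "set_integrable lborel {0<..<1} g"
    unfolding g_def using assms by (intro set_integrable_ext_Beta_integrand) auto
  have beta: "ext_Beta \<nu> (b + of_nat n) (c - b) p = (LBINT t:{0<..<1}. of_real t ^ n * g t)" for n
    unfolding g_def by (rule ext_Beta_add_of_nat)
  \<comment> \<open>A common form of both series: \<open>q n = pochhammer a n / fact n\<close> gives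
    the hypergeometric one and \<open>q n = 1 / fact n\<close> the confluent one. The factor
    \<open>fact n\<close> compensates the \<open>1 / fact n\<close> already present in the
    terms.\<close>
  have series: "(\<lambda>n. q n * fact n * (ext_Beta \<nu> (b + of_nat n) (c - b) p / B) * (z ^ n / fact n)) sums
      (1 / B * (LBINT t:{0<..<1}. (\<Sum>n. q n * (z * of_real t) ^ n) * g t))"
    if "summable (\<lambda>n. norm (q n * z ^ n))" for q z
    using sums_mult[OF power_moments_sums[OF g that], of "1 / B"]
    by (simp add: beta mult_ac)

  define I where "I = (\<lambda>z. 1 / B * (LBINT t:{0<..<1}. (1 - z * of_real t) powr (- a) * g t))"
  define T where "T = (\<lambda>z n. pochhammer a n * (ext_Beta \<nu> (b + of_nat n) (c - b) p / B) * (z ^ n / fact n))"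
  have "I holomorphic_on cut_plane"
    unfolding I_def
  proof (intro holomorphic_intros holomorphic_on_weighted_integral[OF g open_cut_plane])
    note notin = one_minus_mult_notin_nonpos_Reals
    show "continuous_on {0..1} (\<lambda>t. (1 - z * of_real t) powr (- a))" if "z \<in> cut_plane" for z
      by (intro continuous_on_powr_const_complex continuous_intros notin that)
    show "((\<lambda>z. (1 - z * of_real t) powr (- a)) has_field_derivative
        a * of_real t * (1 - z * of_real t) powr (- a - 1)) (at z)"
      if "z \<in> cut_plane" "t \<in> {0..1}" for z t
      using notin[OF that] by (auto intro!: derivative_eq_intros)
    show "continuous_on (cut_plane \<times> {0..1})
        (\<lambda>(z, t). a * of_real t * (1 - z * of_real t) powr (- a - 1))"
      unfolding case_prod_unfold
      by (intro continuous_intros continuous_on_powr_const_complex notin) auto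
  qed
  moreover have "T z sums I z" if z: "norm z < 1" for z
  proof -
    define q where "q = (\<lambda>n. pochhammer a n / fact n)"
    \<comment> \<open>Binomial series with exponent \<open>- a\<close> at \<open>- y\<close>: the
      sign \<open>(- 1) ^ n\<close> in \<open>(- a gchoose n) = (- 1) ^ n * q n\<close> cancels
      against that of \<open>(- y) ^ n\<close>.\<close>
    have q: "(\<lambda>n. q n * y ^ n) sums (1 - y) powr (- a)" if "norm y < 1" for y
    proof -
      have "(- a gchoose n) * (- y) ^ n = q n * y ^ n" for n
      proof -
        have "(- 1) ^ n * (- y) ^ n = y ^ n"
          by (simp flip: power_mult_distrib)
        then show ?thesis
          by (simp add: gbinomial_pochhammer q_def)
      qed
      with gen_binomial_complex[of "- y" "- a"] that show ?thesis by simp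
    qed
    \<comment> \<open>The midpoint between \<open>norm z\<close> and 1 still lies in the disc of
      convergence; convergence at this larger modulus forces absolute convergence at
      \<open>z\<close>.\<close>
    have "(norm z + 1) / 2 < 1" "norm z < (norm z + 1) / 2" using z by auto
    then have "summable (\<lambda>n. norm (q n * z ^ n))"
      by (intro powser_insidea[OF sums_summable[OF q[of "of_real ((norm z + 1) / 2)"]]])
         (simp_all del: of_real_divide of_real_add)
    from series[OF this] have "T z sums
        (1 / B * (LBINT t:{0<..<1}. (\<Sum>n. q n * (z * of_real t) ^ n) * g t))"
      by (simp add: q_def T_def)
    also have "(LBINT t:{0<..<1}. (\<Sum>n. q n * (z * of_real t) ^ n) * g t) =
        (LBINT t:{0<..<1}. (1 - z * of_real t) powr (- a) * g t)"
    proof (intro set_lebesgue_integral_cong allI impI)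
      fix t :: real assume t: "t \<in> {0<..<1}"
      have "norm (z * of_real t) \<le> norm z"
        using t by (simp add: norm_mult mult_left_le)
      with z have "norm (z * of_real t) < 1" by linarith
      from sums_unique[OF q[OF this]]
      show "(\<Sum>n. q n * (z * of_real t) ^ n) * g t = (1 - z * of_real t) powr (- a) * g t"
        by simp
    qed auto
    finally show ?thesis by (simp add: I_def)
  qed
  \<comment> \<open>\<open>I\<close> witnesses that a continuation exists, so the function picked by
    \<open>SOME\<close> has the defining properties. It need not be \<open>I\<close> as a function
    on all of the plane, hence the separate comparison on the cut plane.\<close>
  ultimately have "\<exists>f. f holomorphic_on cut_plane \<and> (\<forall>z. norm z < 1 \<longrightarrow> T z sums f z)"
    by blast
  from someI_ex[OF this]
  have F: "ext_hypergeometric p \<nu> a b c holomorphic_on cut_plane"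
    "\<And>z. norm z < 1 \<Longrightarrow> T z sums ext_hypergeometric p \<nu> a b c z"
    unfolding ext_hypergeometric_def T_def B_def by auto
  \<comment> \<open>Both functions are sums of the same series on the unit disc, so the identity
    theorem on the connected cut plane makes them agree there.\<close>
  have hyp: "ext_hypergeometric p \<nu> a b c z = I z" if "z \<in> cut_plane" for z
  proof (rule analytic_continuation_open[of "ball 0 1" cut_plane "ext_hypergeometric p \<nu> a b c" I])
    fix y :: complex assume "y \<in> ball 0 1"
    then have "norm y < 1" by simp
    then show "ext_hypergeometric p \<nu> a b c y = I y"
      using F(2) \<open>\<And>z. norm z < 1 \<Longrightarrow> T z sums I z\<close> sums_unique2 by blast
  qed (use that F(1) \<open>I holomorphic_on cut_plane\<close> in
      \<open>auto simp: open_cut_plane connected_cut_plane ball_subset_cut_plane\<close>)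

  have conf: "ext_confluent p \<nu> b c z = 1 / B * (LBINT t:{0<..<1}. exp (z * of_real t) * g t)" for z
  proof -
    have e: "(\<Sum>n. 1 / fact n * y ^ n) = exp y" for y :: complex
      by (simp add: exp_def scaleR_conv_of_real divide_inverse mult_ac)
    have "summable (\<lambda>n. norm (1 / fact n * z ^ n))"
      using summable_norm_exp[of z] by (simp add: norm_mult norm_divide norm_power divide_inverse scaleR_conv_of_real mult_ac)
    from sums_unique[OF series[OF this]] show ?thesis
      unfolding ext_confluent_def B_def[symmetric] e by simp
  qed
  show ?thesis
    using hyp conf by (simp add: I_def g_def B_def mult_ac)
qed

end
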